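(* Let $n\ge 1$ and let $x=(x_{-n+1},\dots,x_{n-1})\in\mathbb{R}^{2n-1}$ be a vector with non-negative entries satisfying $\sum_{d=-n+1}^{n-1}x_d=n$. Then $x$ is the X-ray of an $n\times n$ doubly stochastic matrix if and only if for every non-negative real vector $w=(w_0,\dots,w_{n-1})$ the inequality $$\sum_{d=-n+1}^{n-1}v_d(w)\,x_d\le 2\sum_{i=0}^{n-1}w_i$$ holds, where for each $d$ $$v_d(w)=\min_{\substack{0\le i\le j\le n-1\\ i+j=d+(n-1)}}(w_i+w_j).$$
   Context: The (diagonal) X-ray of an $n\times n$ real matrix $A=(a_{i,j})_{1\le i,j\le n}$ is the vector $x(A)=(x_{-n+1},\dots,x_{n-1})\in\mathbb{R}^{2n-1}$ with $x_d=\sum_{1\le i,j\le n,\ i-j=d}a_{i,j}$ for $-n+1\le d\le n-1$. A doubly stochastic matrix is a non-negative real square matrix all of whose rows and columns sum to $1$. *)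

theory Defs
  imports "Jordan_Normal_Form.Matrix"
begin

definition doubly_stochastic :: "real mat \<Rightarrow> bool" where
  "doubly_stochastic A \<longleftrightarrow>
     square_mat A \<and>
     (\<forall>i < dim_row A. \<forall>j < dim_col A. 0 \<le> A $$ (i, j)) \<and>
     (\<forall>i < dim_row A. (\<Sum>j < dim_col A. A $$ (i, j)) = 1) \<and>
     (\<forall>j < dim_col A. (\<Sum>i < dim_row A. A $$ (i, j)) = 1)"

(* Matrix indices start at 0; the difference i - j is the same as for indices starting at 1.
   A vector (x_{-n+1}, ..., x_{n-1}) is represented by a function on int, of which only
   the values at -n+1, ..., n-1 matter. *)
definition xray :: "real mat \<Rightarrow> int \<Rightarrow> real" where
  "xray A d =
     (\<Sum>(i, j) \<in> {(i, j). i < dim_row A \<and> j < dim_col A \<and> int i - int j = d}. A $$ (i, j))"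

(* For -n+1 <= d <= n-1 the set is finite and nonempty, so Min is the true minimum. *)
definition min_pair_sum :: "nat \<Rightarrow> (nat \<Rightarrow> real) \<Rightarrow> int \<Rightarrow> real" where
  "min_pair_sum n w d =
     Min {w i + w j | i j. i \<le> j \<and> j < n \<and> int i + int j = d + (int n - 1)}"

end

theory Submission
  imports Defs "HOL-Analysis.Function_Topology"
begin

text \<open>The existence of a doubly stochastic matrix with X-ray \<open>x\<close> is the solvability of a
  system of linear equations in non-negative unknowns, one equation for each diagonal, row and
  column. Since the row equations fix the total mass to be \<open>n\<close>, the question is whether a point (the
  right-hand side, scaled by \<open>1/n\<close>) lies in the convex hull of finitely many points, namely of the
  columns of the system. If it does not, a linear functional separates the two
  (\<open>finite_hull_strict_separation\<close>). Its coefficients are a price \<open>g d\<close> for each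
  diagonal and potentials \<open>u i\<close>, \<open>v j\<close> for the rows and columns with
  \<open>g (i - j) \<le> u i + v j\<close>, for which the prices collected from \<open>x\<close> exceed
  \<open>\<Sum>u + \<Sum>v\<close> (\<open>xray_alternative\<close>).

  The weights \<open>w\<close> of the criterion arise from \<open>u\<close> and \<open>v\<close> by symmetrisation. After
  reversing the order of the columns, diagonals become antidiagonals: the position \<open>(i, j)\<close> turns
  into \<open>(i, k)\<close> with \<open>k = n - 1 - j\<close>, and \<open>i - j = d\<close> turns into
  \<open>i + k = d + (n - 1)\<close>. This condition is symmetric in \<open>i\<close> and \<open>k\<close>, so the
  potentials \<open>u i\<close> and \<open>v (n - 1 - i)\<close> may both be replaced by their average \<open>w i\<close>,
  and then \<open>g d\<close> is at most the minimum of \<open>w i + w k\<close> over the antidiagonal. Finally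
  \<open>w\<close> is made non-negative by adding a constant \<open>c\<close> to all weights, which adds
  \<open>2 c n\<close> to both sides of the inequality, as the entries of \<open>x\<close> sum to \<open>n\<close>.

  The converse is weak duality: distributing the minimum for \<open>d\<close> over the entries
  of the \<open>d\<close>-th diagonal and bounding it by \<open>w i + w (n - 1 - j)\<close> leaves row and
  column sums weighted by \<open>w\<close>.\<close>

section \<open>Separating a point from a finitely generated convex hull\<close>

text \<open>The weights vanish outside \<open>J\<close> so that the simplex is a closed subset of a product of compact
  sets, to which Tychonoff's theorem applies.\<close>

lemma compact_standard_simplex:
  fixes J :: "'j set"
  assumes "finite J"
  shows "compact {l :: 'j \<Rightarrow> real. (\<forall>j. j \<notin> J \<longrightarrow> l j = 0) \<and> (\<forall>j\<in>J. 0 \<le> l j) \<and> sum l J = 1}"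
    (is "compact ?S")
proof -
  let ?B = "PiE UNIV (\<lambda>j. if j \<in> J then {0..1} else {0}) :: ('j \<Rightarrow> real) set"
  have "compactin (product_topology (\<lambda>_. euclidean) UNIV) ?B"
    by (subst compactin_PiE) auto
  then have compact: "compact ?B"
    by (simp add: euclidean_product_topology)
  have "continuous_on UNIV (\<lambda>l :: 'j \<Rightarrow> real. sum l J)"
    by (intro continuous_on_sum continuous_on_product_coordinates)
  then have "closed ((\<lambda>l :: 'j \<Rightarrow> real. sum l J) -` {1})"
    by (intro closed_vimage) auto
  with compact have "compact (?B \<inter> (\<lambda>l. sum l J) -` {1})"
    by (rule compact_Int_closed)
  moreover have "?S = ?B \<inter> (\<lambda>l. sum l J) -` {1}"
  proof (rule subset_antisym; rule subsetI)
    fix l assume l: "l \<in> ?S"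
    then have "l j \<le> 1" if "j \<in> J" for j
      using member_le_sum[of j J l] that assms by auto
    with l show "l \<in> ?B \<inter> (\<lambda>l. sum l J) -` {1}"
      by (auto simp: PiE_iff)
  next
    fix l assume l: "l \<in> ?B \<inter> (\<lambda>l. sum l J) -` {1}"
    then have l_j: "l j \<in> (if j \<in> J then {0..1} else {0})" for j
      by (auto simp: PiE_iff)
    have "l j = 0" if "j \<notin> J" for j
      using l_j[of j] that by simp
    moreover have "0 \<le> l j" if "j \<in> J" for j
      using l_j[of j] that by simp
    ultimately show "l \<in> ?S"
      using l by simp
  qed
  ultimately show ?thesis
    by simp
qed

text \<open>The first-order condition for a minimum of a convex quadratic on \<open>[0, 1]\<close> at \<open>0\<close>.\<close>

lemma linear_coeff_nonneg_if_quadratic_nonneg: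
  fixes s q :: real
  assumes "0 \<le> q" and nonneg: "\<And>t. 0 < t \<Longrightarrow> t \<le> 1 \<Longrightarrow> 0 \<le> 2 * t * s + t\<^sup>2 * q"
  shows "0 \<le> s"
proof (rule ccontr)
  assume "\<not> 0 \<le> s"
  define t where "t = min 1 (- s / (q + 1))"
  have "0 < - s / (q + 1)"
    using \<open>\<not> 0 \<le> s\<close> \<open>0 \<le> q\<close> by (intro divide_pos_pos) simp_all
  then have t: "0 < t" "t \<le> 1"
    by (simp_all add: t_def)
  have "t \<le> - s / (q + 1)"
    by (simp add: t_def)
  then have "t * q + t \<le> - s"
    using \<open>0 \<le> q\<close> by (simp add: field_simps)
  then have "2 * s + t * q < 0"
    using t \<open>\<not> 0 \<le> s\<close> by linarith
  then have "t * (2 * s + t * q) < 0"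
    using t by (simp add: mult_pos_neg)
  then show False
    using nonneg[OF t] by (simp add: algebra_simps power2_eq_square)
qed

text \<open>The convex combination closest to \<open>b\<close> in the Euclidean distance exists by compactness. If it
  is not \<open>b\<close> itself, then its residual \<open>r\<close> separates: moving towards any generator \<open>a j\<close>
  does not decrease the distance, whence \<open>\<langle>r, b - a j\<rangle> \<ge> \<langle>r, r\<rangle>\<close>, and \<open>\<langle>r, r\<rangle> > 0\<close>.\<close>

lemma finite_hull_strict_separation:
  fixes a :: "'j \<Rightarrow> 'i \<Rightarrow> real" and b :: "'i \<Rightarrow> real"
  assumes "finite J" "J \<noteq> {}" "finite I"
  obtains
    (in_hull) l where "\<And>j. j \<in> J \<Longrightarrow> 0 \<le> l j" "sum l J = 1"
      "\<And>i. i \<in> I \<Longrightarrow> (\<Sum>j\<in>J. l j * a j i) = b i"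
  | (separated) y c where "\<And>j. j \<in> J \<Longrightarrow> (\<Sum>i\<in>I. y i * a j i) \<le> c" "c < (\<Sum>i\<in>I. y i * b i)"
proof -
  define S where
    "S = {l :: 'j \<Rightarrow> real. (\<forall>j. j \<notin> J \<longrightarrow> l j = 0) \<and> (\<forall>j\<in>J. 0 \<le> l j) \<and> sum l J = 1}"
  define res where "res l i = b i - (\<Sum>j\<in>J. l j * a j i)" for l i
  define unit where "unit k = (\<lambda>j. if j = k then 1 else 0 :: real)" for k :: 'j
  have "compact S"
    unfolding S_def by (rule compact_standard_simplex[OF \<open>finite J\<close>])
  have unit_S: "unit k \<in> S" if "k \<in> J" for k
    using that \<open>finite J\<close> by (auto simp: S_def unit_def)
  then have "S \<noteq> {}"
    using \<open>J \<noteq> {}\<close> by blast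
  have "continuous_on S (\<lambda>l. \<Sum>i\<in>I. (res l i)\<^sup>2)"
    unfolding res_def
    by (intro continuous_intros continuous_on_subset[OF continuous_on_product_coordinates]) auto
  then obtain m where "m \<in> S"
    and minimal: "\<And>l. l \<in> S \<Longrightarrow> (\<Sum>i\<in>I. (res m i)\<^sup>2) \<le> (\<Sum>i\<in>I. (res l i)\<^sup>2)"
    using continuous_attains_inf[OF \<open>compact S\<close> \<open>S \<noteq> {}\<close>] by blast
  show thesis
  proof (cases "\<forall>i\<in>I. res m i = 0")
    case True
    show thesis
      using \<open>m \<in> S\<close> True by (intro in_hull[of m]) (auto simp: S_def res_def)
  next
    case False
    then have pos: "0 < (\<Sum>i\<in>I. (res m i)\<^sup>2)"
      using \<open>finite I\<close> by (auto intro: sum_pos2)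
    have "(\<Sum>i\<in>I. res m i * a k i) \<le> (\<Sum>i\<in>I. res m i * b i) - (\<Sum>i\<in>I. (res m i)\<^sup>2)"
      if "k \<in> J" for k
    proof -
      define p where "p i = (b i - a k i) - res m i" for i
      have "0 \<le> (\<Sum>i\<in>I. res m i * p i)"
      proof (rule linear_coeff_nonneg_if_quadratic_nonneg)
        show "0 \<le> (\<Sum>i\<in>I. (p i)\<^sup>2)"
          by (simp add: sum_nonneg)
      next
        fix t :: real
        assume t: "0 < t" "t \<le> 1"
        define l where "l j = (1 - t) * m j + t * unit k j" for j
        have "l \<in> S"
          using t \<open>m \<in> S\<close> unit_S[OF that]
          by (auto simp: S_def l_def sum.distrib simp flip: sum_distrib_left)
        have "(\<Sum>j\<in>J. l j * a j i) = (1 - t) * (\<Sum>j\<in>J. m j * a j i) + t * a k i" for i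
        proof -
          have "(\<Sum>j\<in>J. unit k j * a j i) = a k i"
            using that \<open>finite J\<close> by (simp add: unit_def if_distrib[of "\<lambda>z. z * _"] cong: if_cong)
          moreover have "(\<Sum>j\<in>J. l j * a j i) =
              (\<Sum>j\<in>J. (1 - t) * (m j * a j i) + t * (unit k j * a j i))"
            by (simp add: l_def ring_distribs mult.assoc)
          ultimately show ?thesis
            by (simp only: sum.distrib flip: sum_distrib_left)
        qed
        then have res_l: "res l i = res m i + t * p i" for i
          by (simp add: res_def p_def algebra_simps)
        have "(\<Sum>i\<in>I. (res l i)\<^sup>2) =
            (\<Sum>i\<in>I. (res m i)\<^sup>2) + (2 * t * (\<Sum>i\<in>I. res m i * p i) + t\<^sup>2 * (\<Sum>i\<in>I. (p i)\<^sup>2))"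
          by (simp add: res_l power2_sum power_mult_distrib sum.distrib sum_distrib_left
              algebra_simps)
        with minimal[OF \<open>l \<in> S\<close>]
        show "0 \<le> 2 * t * (\<Sum>i\<in>I. res m i * p i) + t\<^sup>2 * (\<Sum>i\<in>I. (p i)\<^sup>2)"
          by simp
      qed
      then show ?thesis
        by (simp add: p_def algebra_simps power2_eq_square sum.distrib sum_subtractf)
    qed
    with pos show thesis
      by (intro separated[of "res m" "(\<Sum>i\<in>I. res m i * b i) - (\<Sum>i\<in>I. (res m i)\<^sup>2)"]) auto
  qed
qed

section \<open>The alternative for X-rays of doubly stochastic matrices\<close>

text \<open>The generators are indexed by the positions of the matrix; the generator of \<open>(i, j)\<close> is the
  indicator vector of the diagonal, the row and the column through \<open>(i, j)\<close>. A convex combination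
  of them is a non-negative matrix of total mass \<open>1\<close>, recorded through its line sums; scaling
  by \<open>n\<close> gives the doubly stochastic matrix.\<close>

lemma xray_alternative:
  fixes n :: nat and x :: "int \<Rightarrow> real"
  assumes "n \<ge> 1"
  obtains
    (matrix) A where "A \<in> carrier_mat n n" "doubly_stochastic A"
      "\<And>d. d \<in> {- int n + 1..int n - 1} \<Longrightarrow> x d = xray A d"
  | (potentials) g u v where
      "\<And>i j. i < n \<Longrightarrow> j < n \<Longrightarrow> g (int i - int j) \<le> u i + v j"
      "(\<Sum>i<n. u i) + (\<Sum>j<n. v j) < (\<Sum>d = - int n + 1..int n - 1. g d * x d)"
proof -
  define D where "D = {- int n + 1..int n - 1}"
  define a :: "nat \<times> nat \<Rightarrow> int + nat + nat \<Rightarrow> real" where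
    "a p = case_sum (\<lambda>d. of_bool (int (fst p) - int (snd p) = d))
      (case_sum (\<lambda>k. of_bool (fst p = k)) (\<lambda>k. of_bool (snd p = k)))" for p
  define b :: "int + nat + nat \<Rightarrow> real" where
    "b = case_sum (\<lambda>d. x d / n) (\<lambda>_. 1 / n)"
  let ?J = "{..<n} \<times> {..<n}" and ?I = "D <+> ({..<n} <+> {..<n})"
  have fin: "finite D"
    by (simp add: D_def)
  have n: "real n \<noteq> 0"
    using assms by simp
  have "finite ?J" "?J \<noteq> {}" "finite ?I"
    using assms fin by (auto simp: lessThan_empty_iff)
  then show thesis
  proof (cases rule: finite_hull_strict_separation[of ?J ?I a b])
    case (in_hull l)
    define A where "A = mat n n (\<lambda>p. n * l p)"
    have A: "A \<in> carrier_mat n n"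
      by (simp add: A_def)
    have diag: "(\<Sum>p\<in>?J \<inter> {p. int (fst p) - int (snd p) = d}. l p) = x d / n" if "d \<in> D" for d
      using in_hull(3)[OF InlI[OF that]] by (simp add: a_def b_def)
    have row: "(\<Sum>j<n. l (i, j)) = 1 / n" if "i < n" for i
    proof -
      have "1 / n = (\<Sum>k<n. \<Sum>j<n. l (k, j) * of_bool (k = i))"
        using in_hull(3)[OF InrI[OF InlI]] that
        by (simp add: a_def b_def sum.cartesian_product' del: sum_mult_of_bool_eq)
      also have "\<dots> = (\<Sum>k<n. (\<Sum>j<n. l (k, j)) * of_bool (k = i))"
        by (simp add: sum_distrib_right del: sum_mult_of_bool_eq)
      also have "\<dots> = (\<Sum>j<n. l (i, j))"
      proof -
        have "{..<n} \<inter> {k. k = i} = {i}" using that by auto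
        then show ?thesis by simp
      qed
      finally show ?thesis ..
    qed
    have column: "(\<Sum>i<n. l (i, j)) = 1 / n" if "j < n" for j
    proof -
      have "1 / n = (\<Sum>i<n. \<Sum>k<n. l (i, k) * of_bool (k = j))"
        using in_hull(3)[OF InrI[OF InrI]] that
        by (simp add: a_def b_def sum.cartesian_product' del: sum_mult_of_bool_eq)
      also have "\<dots> = (\<Sum>i<n. l (i, j))"
      proof -
        have "{..<n} \<inter> {k. k = j} = {j}" using that by auto
        then show ?thesis by simp
      qed
      finally show ?thesis ..
    qed
    have "doubly_stochastic A"
      using in_hull(1) row column n
      by (auto simp: doubly_stochastic_def A_def simp flip: sum_distrib_left)
    moreover have "x d = xray A d" if "d \<in> D" for d
    proof -
      have "xray A d = (\<Sum>p\<in>?J \<inter> {p. int (fst p) - int (snd p) = d}. n * l p)"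
        unfolding xray_def by (rule sum.cong) (auto simp: A_def)
      then show ?thesis
        using diag[OF that] n by (simp flip: sum_distrib_left)
    qed
    ultimately show thesis
      using A by (intro matrix) (auto simp: D_def)
  next
    case (separated y c)
    define g where "g d = y (Inl d)" for d
    define r where "r i = y (Inr (Inl i))" for i
    define s where "s j = y (Inr (Inr j))" for j
    have split: "(\<Sum>i\<in>?I. y i * f i) = (\<Sum>d\<in>D. g d * f (Inl d)) +
        ((\<Sum>i<n. r i * f (Inr (Inl i))) + (\<Sum>j<n. s j * f (Inr (Inr j))))" for f
      using fin by (simp add: sum.Plus g_def r_def s_def)
    have position: "g (int i - int j) + (r i + s j) \<le> c" if "i < n" "j < n" for i j
    proof -
      have "D \<inter> {d. int i - int j = d} = {int i - int j}"
        "{..<n} \<inter> {k. i = k} = {i}" "{..<n} \<inter> {k. j = k} = {j}"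
        using that by (auto simp: D_def)
      then have "(\<Sum>k\<in>?I. y k * a (i, j) k) = g (int i - int j) + (r i + s j)"
        using fin by (simp add: split a_def)
      then show ?thesis
        using separated(1)[of "(i, j)"] that by simp
    qed
    have "c < (\<Sum>d\<in>D. g d * x d) / n + ((\<Sum>i<n. r i) / n + (\<Sum>j<n. s j) / n)"
      using separated(2) by (simp add: split b_def sum_divide_distrib)
    then have total: "n * c < (\<Sum>d\<in>D. g d * x d) + ((\<Sum>i<n. r i) + (\<Sum>j<n. s j))"
      using assms by (simp add: field_simps)
    \<comment> \<open>the constant \<open>c\<close> is shared equally between rows and columns\<close>
    show thesis
    proof (rule potentials[of g "\<lambda>i. c / 2 - r i" "\<lambda>j. c / 2 - s j"])
      show "g (int i - int j) \<le> c / 2 - r i + (c / 2 - s j)" if "i < n" "j < n" for i j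
        using position[OF that] by simp
      show "(\<Sum>i<n. c / 2 - r i) + (\<Sum>j<n. c / 2 - s j)
          < (\<Sum>d = - int n + 1..int n - 1. g d * x d)"
        using total by (simp add: sum_subtractf D_def mult.commute[of c])
    qed
  qed
qed

section \<open>Minimal pair sums\<close>

lemma finite_pair_sums:
  "finite {w i + w j | i j :: nat. i \<le> j \<and> j < n \<and> P i j}"
  by (rule finite_subset[of _ "(\<lambda>(i, j). w i + w j) ` ({..<n} \<times> {..<n})"]) auto

text \<open>A pair with \<open>k < i\<close> is represented in the minimum by its mirror image \<open>(k, i)\<close>, which lies
  on the same antidiagonal and has the same sum.\<close>

lemma min_pair_sum_le:
  assumes "i < n" "k < n" "int i + int k = d + (int n - 1)"
  shows "min_pair_sum n w d \<le> w i + w k"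
  unfolding min_pair_sum_def
proof (rule Min_le[OF finite_pair_sums])
  show "w i + w k \<in> {w i + w j | i j. i \<le> j \<and> j < n \<and> int i + int j = d + (int n - 1)}"
  proof (cases "i \<le> k")
    case True
    then show ?thesis using assms by blast
  next
    case False
    then have "w i + w k = w k + w i \<and> k \<le> i \<and> i < n \<and> int k + int i = d + (int n - 1)"
      using assms by auto
    then show ?thesis by blast
  qed
qed

lemma min_pair_sum_ge:
  assumes d: "d \<in> {- int n + 1..int n - 1}"
    and bound: "\<And>i k. i < n \<Longrightarrow> k < n \<Longrightarrow> int i + int k = d + (int n - 1) \<Longrightarrow> c \<le> w i + w k"
  shows "c \<le> min_pair_sum n w d"
  unfolding min_pair_sum_def
proof (rule Min.boundedI[OF finite_pair_sums])
  \<comment> \<open>\<open>(i, k)\<close> is the endpoint of the antidiagonal in row \<open>0\<close> or column \<open>n - 1\<close>\<close>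
  define i k where "i = nat (max 0 d)" and "k = nat (min (d + (int n - 1)) (int n - 1))"
  have "i < n" "k < n" "int i + int k = d + (int n - 1)"
    using d by (auto simp: i_def k_def)
  then have ordered: "min i k \<le> max i k" "max i k < n" "int (min i k) + int (max i k) = d + (int n - 1)"
    by (simp_all add: min_def max_def)
  have "w (min i k) + w (max i k) \<in>
      {w i + w j | i j. i \<le> j \<and> j < n \<and> int i + int j = d + (int n - 1)}"
    by (intro CollectI exI[of _ "min i k"] exI[of _ "max i k"] conjI refl ordered)
  then show "{w i + w j | i j. i \<le> j \<and> j < n \<and> int i + int j = d + (int n - 1)} \<noteq> {}"
    by (rule ex_in_conv[THEN iffD1, OF exI])
next
  fix z assume "z \<in> {w i + w j | i j. i \<le> j \<and> j < n \<and> int i + int j = d + (int n - 1)}"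
  then show "c \<le> z"
    using bound by auto
qed

section \<open>The criterion\<close>

lemma xray_weighted_sum:
  assumes "A \<in> carrier_mat n n"
  shows "(\<Sum>d = - int n + 1..int n - 1. f d * xray A d) =
    (\<Sum>i<n. \<Sum>j<n. f (int i - int j) * A $$ (i, j))"
proof -
  have "f d * xray A d = (\<Sum>p | p \<in> {..<n} \<times> {..<n} \<and> int (fst p) - int (snd p) = d.
      f (int (fst p) - int (snd p)) * A $$ p)" for d
    unfolding xray_def sum_distrib_left using assms by (intro sum.cong) auto
  then have "(\<Sum>d = - int n + 1..int n - 1. f d * xray A d) =
      (\<Sum>p\<in>{..<n} \<times> {..<n}. f (int (fst p) - int (snd p)) * A $$ p)"
    by (simp only:) (rule sum.group, auto)
  then show ?thesis
    by (simp add: sum.cartesian_product')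
qed

lemma min_pair_sum_xray_le:
  assumes A: "A \<in> carrier_mat n n" and "doubly_stochastic A"
  shows "(\<Sum>d = - int n + 1..int n - 1. min_pair_sum n w d * xray A d) \<le> 2 * (\<Sum>i<n. w i)"
proof -
  have nonneg: "0 \<le> A $$ (i, j)" if "i < n" "j < n" for i j
    using assms that by (auto simp: doubly_stochastic_def)
  have row: "(\<Sum>j<n. A $$ (i, j)) = 1" if "i < n" for i
    using assms that by (auto simp: doubly_stochastic_def)
  have column: "(\<Sum>i<n. A $$ (i, j)) = 1" if "j < n" for j
    using assms that by (auto simp: doubly_stochastic_def)
  have "(\<Sum>d = - int n + 1..int n - 1. min_pair_sum n w d * xray A d) =
      (\<Sum>i<n. \<Sum>j<n. min_pair_sum n w (int i - int j) * A $$ (i, j))"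
    by (rule xray_weighted_sum[OF A])
  also have "\<dots> \<le> (\<Sum>i<n. \<Sum>j<n. (w i + w (n - Suc j)) * A $$ (i, j))"
    using nonneg by (intro sum_mono mult_right_mono min_pair_sum_le) (auto simp: of_nat_diff)
  also have "\<dots> = (\<Sum>i<n. \<Sum>j<n. w i * A $$ (i, j)) + (\<Sum>i<n. \<Sum>j<n. w (n - Suc j) * A $$ (i, j))"
    by (simp add: ring_distribs sum.distrib)
  also have "(\<Sum>i<n. \<Sum>j<n. w (n - Suc j) * A $$ (i, j)) =
      (\<Sum>j<n. \<Sum>i<n. w (n - Suc j) * A $$ (i, j))"
    by (rule sum.swap)
  also have "(\<Sum>i<n. \<Sum>j<n. w i * A $$ (i, j)) + \<dots> = (\<Sum>i<n. w i) + (\<Sum>j<n. w (n - Suc j))"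
    using row column by (simp flip: sum_distrib_left)
  also have "\<dots> = 2 * (\<Sum>i<n. w i)"
    by (simp add: sum.nat_diff_reindex)
  finally show ?thesis .
qed

text \<open>The symmetrisation step. The average \<open>h\<close> of the two potentials already violates the
  inequality but may take negative values; \<open>M\<close> is large enough to lift it above \<open>0\<close>,
  and \<open>x\<close> having sum \<open>n\<close> keeps the gap between the two sides unchanged.\<close>

lemma weights_of_potentials:
  fixes n :: nat and x :: "int \<Rightarrow> real"
  assumes x_nonneg: "\<forall>d \<in> {- int n + 1..int n - 1}. 0 \<le> x d"
    and x_sum: "(\<Sum>d = - int n + 1..int n - 1. x d) = real n"
    and dominated: "\<And>i j. i < n \<Longrightarrow> j < n \<Longrightarrow> g (int i - int j) \<le> u i + v j"
    and violated: "(\<Sum>i<n. u i) + (\<Sum>j<n. v j) < (\<Sum>d = - int n + 1..int n - 1. g d * x d)"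
  shows "\<exists>w. (\<forall>i<n. 0 \<le> w i) \<and>
    2 * (\<Sum>i<n. w i) < (\<Sum>d = - int n + 1..int n - 1. min_pair_sum n w d * x d)"
proof -
  define h where "h i = (u i + v (n - Suc i)) / 2" for i
  define M where "M = (\<Sum>i<n. \<bar>h i\<bar>)"
  define w where "w i = h i + M" for i
  have w_nonneg: "0 \<le> w i" if "i < n" for i
    using member_le_sum[of i "{..<n}" "\<lambda>i. \<bar>h i\<bar>"] that by (simp add: w_def M_def)
  have "g d + 2 * M \<le> min_pair_sum n w d" if "d \<in> {- int n + 1..int n - 1}" for d
  proof (rule min_pair_sum_ge[OF that])
    fix i k assume ik: "i < n" "k < n" "int i + int k = d + (int n - 1)"
    \<comment> \<open>both \<open>(i, k)\<close> and its mirror image \<open>(k, i)\<close> lie on the antidiagonal of \<open>d\<close>\<close>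
    have "g d \<le> u i + v (n - Suc k)" "g d \<le> u k + v (n - Suc i)"
      using dominated[of i "n - Suc k"] dominated[of k "n - Suc i"] ik
      by (simp_all add: of_nat_diff algebra_simps)
    then show "g d + 2 * M \<le> w i + w k"
      by (simp add: w_def h_def field_simps)
  qed
  then have "(\<Sum>d = - int n + 1..int n - 1. (g d + 2 * M) * x d)
      \<le> (\<Sum>d = - int n + 1..int n - 1. min_pair_sum n w d * x d)"
    using x_nonneg by (intro sum_mono mult_right_mono) auto
  moreover have "(\<Sum>d = - int n + 1..int n - 1. (g d + 2 * M) * x d) =
      (\<Sum>d = - int n + 1..int n - 1. g d * x d) + 2 * M * n"
    using x_sum by (simp add: ring_distribs sum.distrib flip: sum_distrib_left)
  moreover have "2 * (\<Sum>i<n. w i) = (\<Sum>i<n. u i) + (\<Sum>j<n. v j) + 2 * M * n"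
    by (simp add: w_def h_def sum.distrib sum.nat_diff_reindex flip: sum_divide_distrib)
  ultimately show ?thesis
    using violated w_nonneg by (intro exI[of _ w]) auto
qed

theorem proposition3p1:
  fixes n :: nat and x :: "int \<Rightarrow> real"
  assumes "n \<ge> 1"
    and "\<forall>d \<in> {- int n + 1..int n - 1}. 0 \<le> x d"
    and "(\<Sum>d = - int n + 1..int n - 1. x d) = real n"
  shows "(\<exists>A \<in> carrier_mat n n. doubly_stochastic A \<and>
             (\<forall>d \<in> {- int n + 1..int n - 1}. x d = xray A d))
     \<longleftrightarrow>
         (\<forall>w :: nat \<Rightarrow> real. (\<forall>i < n. 0 \<le> w i) \<longrightarrow>
             (\<Sum>d = - int n + 1..int n - 1. min_pair_sum n w d * x d) \<le> 2 * (\<Sum>i < n. w i))"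
    (is "?feasible \<longleftrightarrow> ?criterion")
proof
  assume ?feasible
  then obtain A where A: "A \<in> carrier_mat n n" "doubly_stochastic A"
    and x: "\<forall>d \<in> {- int n + 1..int n - 1}. x d = xray A d"
    by blast
  have "(\<Sum>d = - int n + 1..int n - 1. min_pair_sum n w d * x d) \<le> 2 * (\<Sum>i<n. w i)" for w
    using min_pair_sum_xray_le[OF A, of w] x by simp
  then show ?criterion
    by blast
next
  assume criterion: ?criterion
  from assms(1) show ?feasible
  proof (cases rule: xray_alternative[of n x])
    case (matrix A)
    then show ?thesis by blast
  next
    case (potentials g u v)
    have "\<exists>w. (\<forall>i<n. 0 \<le> w i) \<and>
        2 * (\<Sum>i<n. w i) < (\<Sum>d = - int n + 1..int n - 1. min_pair_sum n w d * x d)"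
      using assms(2,3) potentials by (rule weights_of_potentials)
    with criterion show ?thesis
      by (meson not_le)
  qed
qed

end
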